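(* Let $R$ be a ring. Then $R$ is strongly semi-nil clean if and only if $R$ is periodic.
   Context: Rings are associative with identity, not necessarily commutative. An element $x$ of a ring $R$ is periodic if there exist two different positive integers $m\neq n$ with $x^m=x^n$; a ring is periodic if all its elements are periodic. An element $x\in R$ is strongly semi-nil clean if $x=a+b$ for some periodic element $a\in R$ and some nilpotent element $b\in R$ with $ab=ba$; a ring is strongly semi-nil clean if all its elements are strongly semi-nil clean. *)

theory Defs
  imports "HOL-Algebra.Ring"
begin

text \<open>
  Rings are those of the locale \<^locale>\<open>ring\<close>: associative with identity, not
  necessarily commutative, and possibly the zero ring. In the definitions below,
  membership of the element in the carrier is part of the predicate.
\<close>

definition periodic_element :: "('a, 'b) ring_scheme \<Rightarrow> 'a \<Rightarrow> bool" where
  "periodic_element R x \<longleftrightarrow> x \<in> carrier R \<and>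
     (\<exists>m n :: nat. 0 < m \<and> 0 < n \<and> m \<noteq> n \<and> x [^]\<^bsub>R\<^esub> m = x [^]\<^bsub>R\<^esub> n)"

definition periodic_ring :: "('a, 'b) ring_scheme \<Rightarrow> bool" where
  "periodic_ring R \<longleftrightarrow> (\<forall>x \<in> carrier R. periodic_element R x)"

definition nilpotent_element :: "('a, 'b) ring_scheme \<Rightarrow> 'a \<Rightarrow> bool" where
  "nilpotent_element R x \<longleftrightarrow> x \<in> carrier R \<and>
     (\<exists>n :: nat. 0 < n \<and> x [^]\<^bsub>R\<^esub> n = \<zero>\<^bsub>R\<^esub>)"

definition strongly_semi_nil_clean_element :: "('a, 'b) ring_scheme \<Rightarrow> 'a \<Rightarrow> bool" where
  "strongly_semi_nil_clean_element R x \<longleftrightarrow> x \<in> carrier R \<and>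
     (\<exists>a b. periodic_element R a \<and> nilpotent_element R b \<and>
        x = a \<oplus>\<^bsub>R\<^esub> b \<and> a \<otimes>\<^bsub>R\<^esub> b = b \<otimes>\<^bsub>R\<^esub> a)"

definition strongly_semi_nil_clean_ring :: "('a, 'b) ring_scheme \<Rightarrow> bool" where
  "strongly_semi_nil_clean_ring R \<longleftrightarrow>
     (\<forall>x \<in> carrier R. strongly_semi_nil_clean_element R x)"

end

(* Writing 1 + 1 = a + b shows that 2^n - 2^m is nilpotent whenever a^m = a^n, so R has
   positive characteristic N. For x = a + b, the subring generated by a and b is commutative,
   and (a + d)^N = a^N + N a^(N-1) d + d^2 y shows that raising to the N-th power squares the
   nilpotent error term. After finitely many steps x^r = a^r, so x is periodic like a. *)

theory Submission
  imports Defs "HOL-Algebra.Subrings"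
begin

lemma (in ring) commuting_pair_subcring:
  assumes "a \<in> carrier R" "b \<in> carrier R" "a \<otimes> b = b \<otimes> a"
  obtains S where "subcring S R" "a \<in> S" "b \<in> S"
proof -
  \<comment> \<open>The double centralizer of two commuting elements is commutative.\<close>
  define C where "C = {x \<in> carrier R. a \<otimes> x = x \<otimes> a \<and> b \<otimes> x = x \<otimes> b}"
  define S where "S = {x \<in> carrier R. \<forall>y \<in> C. x \<otimes> y = y \<otimes> x}"
  have aC: "a \<in> C" "b \<in> C" and aS: "a \<in> S" "b \<in> S"
    using assms by (auto simp: C_def S_def)
  \<comment> \<open>Members of \<open>S\<close> commute with everything in \<open>C\<close>, in
    particular with \<open>a\<close> and \<open>b\<close>, which puts them in \<open>C\<close>. This
    inclusion is what later makes any two members of \<open>S\<close> commute.\<close>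
  have SC: "S \<subseteq> C"
    using aC unfolding S_def C_def by auto
  have "subring S R"
  proof (rule subringI)
    show "S \<subseteq> carrier R" "\<one> \<in> S"
      by (auto simp: S_def C_def)
  next
    fix x assume "x \<in> S"
    then show "\<ominus> x \<in> S"
      by (auto simp: S_def C_def l_minus r_minus)
  next
    fix x y assume xy: "x \<in> S" "y \<in> S"
    then show "x \<oplus> y \<in> S"
      by (auto simp: S_def C_def l_distr r_distr)
    have "x \<otimes> y \<otimes> z = z \<otimes> (x \<otimes> y)" if "z \<in> C" for z
    proof -
      have "z \<in> carrier R" using that by (simp add: C_def)
      moreover have "x \<in> carrier R" "y \<in> carrier R" "x \<otimes> z = z \<otimes> x" "y \<otimes> z = z \<otimes> y"
        using xy that by (auto simp: S_def)
      ultimately show ?thesis by (metis m_assoc)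
    qed
    then show "x \<otimes> y \<in> S"
      using xy by (auto simp: S_def)
  qed
  moreover have "x \<otimes> y = y \<otimes> x" if "x \<in> S" "y \<in> S" for x y
    using that SC by (auto simp: S_def)
  ultimately have "subcring S R"
    by (simp add: subcring_def subcring_axioms_def)
  with aS show thesis by (rule that[rotated])
qed

text \<open>The binomial expansion to second order in \<open>d\<close>, proved by multiplying by
  \<open>a \<oplus> d\<close> once more. The exponent \<open>Suc k\<close> makes the cofactor
  \<open>a [^] k\<close> available without subtraction, and the linear coefficient stays an integer
  multiple so that torsion can kill it later.\<close>

lemma (in cring) add_pow_expand_linear:
  assumes "a \<in> carrier R" "d \<in> carrier R"
  shows "\<exists>y \<in> carrier R.
    (a \<oplus> d) [^] Suc k = a [^] Suc k \<oplus> [Suc k] \<cdot> (a [^] k \<otimes> d) \<oplus> d \<otimes> d \<otimes> y"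
proof (induction k)
  case 0
  have "(a \<oplus> d) [^] Suc 0 = a [^] Suc 0 \<oplus> [Suc 0] \<cdot> (a [^] (0::nat) \<otimes> d) \<oplus> d \<otimes> d \<otimes> \<zero>"
    using assms by (simp add: add.nat_pow_Suc)
  then show ?case by blast
next
  case (Suc k)
  then obtain y where y: "y \<in> carrier R"
    "(a \<oplus> d) [^] Suc k = a [^] Suc k \<oplus> [Suc k] \<cdot> (a [^] k \<otimes> d) \<oplus> d \<otimes> d \<otimes> y"
    by blast
  \<comment> \<open>The new quadratic cofactor: the old remainder times \<open>a \<oplus> d\<close>,
    plus the share that the linear term contributes when multiplied by \<open>d\<close>.\<close>
  define z where "z = y \<otimes> (a \<oplus> d) \<oplus> [Suc k] \<cdot> (a [^] k)"
  define p where "p = a [^] k"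
  \<comment> \<open>Replacing the integer multiple by multiplication with a ring element
    \<open>c\<close> turns the goal into a polynomial identity that \<open>algebra\<close> can
    decide.\<close>
  define c where "c = [Suc k] \<cdot> \<one>"
  have p: "p \<in> carrier R" and c: "c \<in> carrier R" using assms by (auto simp: p_def c_def)
  have cs: "[Suc k] \<cdot> u = c \<otimes> u" if "u \<in> carrier R" for u
    unfolding c_def using that add_pow_ldistr[of \<one> u "Suc k"] by simp
  have cs': "[Suc (Suc k)] \<cdot> u = c \<otimes> u \<oplus> u" if "u \<in> carrier R" for u
    using cs[OF that] add.nat_pow_Suc[of "Suc k" u] by simp
  have pS: "a [^] Suc k = p \<otimes> a" by (simp add: p_def)
  have "(a \<oplus> d) [^] Suc (Suc k) = (p \<otimes> a \<oplus> c \<otimes> (p \<otimes> d) \<oplus> d \<otimes> d \<otimes> y) \<otimes> (a \<oplus> d)"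
    using y(2) cs[of "p \<otimes> d"] p assms pS unfolding p_def[symmetric] by simp
  also have "\<dots> = p \<otimes> a \<otimes> a \<oplus> (c \<otimes> (p \<otimes> a \<otimes> d) \<oplus> p \<otimes> a \<otimes> d)
      \<oplus> d \<otimes> d \<otimes> (y \<otimes> (a \<oplus> d) \<oplus> c \<otimes> p)"
    using p c y(1) assms by algebra
  also have "\<dots> = a [^] Suc (Suc k) \<oplus> [Suc (Suc k)] \<cdot> (a [^] Suc k \<otimes> d) \<oplus> d \<otimes> d \<otimes> z"
    using p c y(1) assms cs cs'[of "p \<otimes> a \<otimes> d"] pS
    unfolding z_def p_def[symmetric] by simp
  finally show ?case
    using y(1) assms by (auto simp: z_def simp del: nat_pow_Suc)
qed

text \<open>This is the expansion modulo \<open>b\<close>: the linear and the quadratic term both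
  contain the factor \<open>b\<close>.\<close>

lemma (in cring) pow_add_multiple:
  assumes "a \<in> carrier R" "b \<in> carrier R"
  shows "\<exists>y \<in> carrier R. (a \<oplus> b) [^] (k::nat) = a [^] k \<oplus> b \<otimes> y"
proof (cases k)
  case 0
  then show ?thesis using assms by (auto intro!: bexI[of _ \<zero>])
next
  case (Suc j)
  define c where "c = [Suc j] \<cdot> (a [^] j)"
  have c: "c \<in> carrier R" using assms by (auto simp: c_def)
  obtain y where y: "y \<in> carrier R"
    "(a \<oplus> b) [^] Suc j = a [^] Suc j \<oplus> [Suc j] \<cdot> (a [^] j \<otimes> b) \<oplus> b \<otimes> b \<otimes> y"
    using add_pow_expand_linear[OF assms] by blast
  have e: "[Suc j] \<cdot> (a [^] j \<otimes> b) = c \<otimes> b"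
    unfolding c_def using assms add_pow_ldistr[of "a [^] j" b "Suc j"] by simp
  have "a [^] Suc j \<in> carrier R" using assms by blast
  then have "(a \<oplus> b) [^] Suc j = a [^] Suc j \<oplus> b \<otimes> (c \<oplus> b \<otimes> y)"
    unfolding y(2) e using c y(1) assms by algebra
  then show ?thesis using Suc c y assms by blast
qed

text \<open>Modulo \<open>b\<close>, 2 equals \<open>a\<close>, so \<open>2 ^ m\<close> and
  \<open>2 ^ n\<close> agree there. Their difference \<open>M\<close> is thus a multiple of
  \<open>b\<close> in the ring, and \<open>N = M ^ k\<close> works.\<close>

lemma (in cring) torsion_of_two_eq_periodic_add_nilpotent:
  assumes "a \<in> carrier R" "b \<in> carrier R" "\<one> \<oplus> \<one> = a \<oplus> b"
    and "a [^] (m::nat) = a [^] n" "m < n" "b [^] (k::nat) = \<zero>"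
  shows "\<exists>N::nat. N > 0 \<and> [N] \<cdot> \<one> = \<zero>"
proof -
  \<comment> \<open>The map from naturals to multiples of \<open>\<one>\<close> respects powers.
    This is used with base 2 for the comparison and with base \<open>M\<close> for
    nilpotency.\<close>
  have pow2: "[(M ^ j)] \<cdot> \<one> = ([M] \<cdot> \<one>) [^] j" for M j :: nat
  proof (induction j)
    case (Suc j)
    have "[(M ^ Suc j)] \<cdot> \<one> = [(M ^ j)] \<cdot> ([M] \<cdot> \<one>)"
      by (simp add: add.nat_pow_pow)
    also have "\<dots> = [(M ^ j)] \<cdot> \<one> \<otimes> [M] \<cdot> \<one>"
      using add_pow_ldistr[of \<one> "[M] \<cdot> \<one>" "M ^ j"] by simp
    finally show ?case using Suc by simp
  qed simp
  have two: "[(2::nat)] \<cdot> \<one> = a \<oplus> b"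
    using assms(3) add.nat_pow_Suc[of 1 \<one>] by (simp add: numeral_2_eq_2)
  \<comment> \<open>Both expansions have the same leading term \<open>a [^] n\<close>, since
    \<open>a [^] m\<close> equals it; it cancels in the difference.\<close>
  obtain y z where y: "y \<in> carrier R" "[((2::nat) ^ m)] \<cdot> \<one> = a [^] n \<oplus> b \<otimes> y"
    and z: "z \<in> carrier R" "[((2::nat) ^ n)] \<cdot> \<one> = a [^] n \<oplus> b \<otimes> z"
    using pow_add_multiple[OF assms(1,2), of m] pow_add_multiple[OF assms(1,2), of n]
    unfolding pow2 two assms(4) by blast
  define M where "M = (2::nat) ^ n - 2 ^ m"
  have M: "M > 0" "2 ^ n = M + 2 ^ m"
    using \<open>m < n\<close> power_strict_increasing[of m n "2::nat"] by (auto simp: M_def)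
  define A where "A = a [^] n"
  define B where "B = [M] \<cdot> \<one>"
  have A: "A \<in> carrier R" and B: "B \<in> carrier R" using assms by (auto simp: A_def B_def)
  have e: "B \<oplus> (A \<oplus> b \<otimes> y) = A \<oplus> b \<otimes> z"
    using y(2) z(2) add.nat_pow_mult[of \<one> M "2 ^ m"] unfolding M(2) A_def B_def by simp
  have "B = (B \<oplus> (A \<oplus> b \<otimes> y)) \<ominus> (A \<oplus> b \<otimes> y)"
    using A B y(1) assms by (simp add: a_minus_def a_assoc r_neg)
  also have "\<dots> = b \<otimes> (z \<ominus> y)"
    unfolding e using A y(1) z(1) assms by algebra
  finally have "B = b \<otimes> (z \<ominus> y)" .
  \<comment> \<open>By commutativity the \<open>k\<close>-th power of \<open>B\<close> contains the
    factor \<open>b [^] k\<close>, which is zero.\<close>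
  then have "[(M ^ k)] \<cdot> \<one> = \<zero>"
    using assms y(1) z(1) unfolding pow2 B_def[symmetric] by (simp add: nat_pow_distrib)
  with M(1) show ?thesis by (metis zero_less_power)
qed

text \<open>The exponent \<open>r = N ^ k\<close> works: after \<open>k\<close> squarings the error
  contains \<open>b [^] (2 ^ k)\<close>, which vanishes.\<close>

lemma (in cring) pow_add_nilpotent_eq_pow:
  assumes "a \<in> carrier R" "b \<in> carrier R" "b [^] (k::nat) = \<zero>"
    and N: "(N::nat) > 0" "[N] \<cdot> \<one> = \<zero>"
  shows "\<exists>r::nat. r > 0 \<and> (a \<oplus> b) [^] r = a [^] r"
proof -
  \<comment> \<open>The error starts as \<open>b\<close> with cofactor \<open>\<one>\<close>. Each
    squaring doubles the exponent of \<open>b\<close>, and all other factors are absorbed into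
    \<open>y\<close>.\<close>
  have step: "\<exists>y \<in> carrier R. (a \<oplus> b) [^] (N ^ t) = a [^] (N ^ t) \<oplus> b [^] ((2::nat) ^ t) \<otimes> y" for t
  proof (induction t)
    case 0
    then show ?case using assms by (auto intro!: bexI[of _ \<one>])
  next
    case (Suc t)
    then obtain y where y: "y \<in> carrier R"
      "(a \<oplus> b) [^] (N ^ t) = a [^] (N ^ t) \<oplus> b [^] ((2::nat) ^ t) \<otimes> y" by blast
    obtain j where j: "N = Suc j" using N(1) gr0_implies_Suc by blast
    define A where "A = a [^] (N ^ t)"
    define q where "q = b [^] ((2::nat) ^ t)"
    have A: "A \<in> carrier R" and q: "q \<in> carrier R" using assms by (auto simp: A_def q_def)
    obtain z where z: "z \<in> carrier R" "(A \<oplus> q \<otimes> y) [^] N =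
        A [^] N \<oplus> [N] \<cdot> (A [^] j \<otimes> (q \<otimes> y)) \<oplus> q \<otimes> y \<otimes> (q \<otimes> y) \<otimes> z"
      using add_pow_expand_linear[of A "q \<otimes> y" j] A q y(1) unfolding j by blast
    \<comment> \<open>Torsion of \<open>\<one>\<close> spreads to every element, so the linear term
      of the expansion disappears.\<close>
    have tors: "[N] \<cdot> u = \<zero>" if "u \<in> carrier R" for u
      using add_pow_ldistr[of \<one> u N] that N(2) by simp
    have "(a \<oplus> b) [^] (N ^ Suc t) = (A \<oplus> q \<otimes> y) [^] N"
      using assms y(2) nat_pow_pow[of "a \<oplus> b" "N ^ t" N]
      by (simp add: A_def q_def mult.commute)
    also have "\<dots> = A [^] N \<oplus> q \<otimes> y \<otimes> (q \<otimes> y) \<otimes> z"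
      using z(2) tors[of "A [^] j \<otimes> (q \<otimes> y)"] A q y(1) by simp
    also have "\<dots> = A [^] N \<oplus> q \<otimes> q \<otimes> (y \<otimes> y \<otimes> z)"
      using nat_pow_closed[OF A, of N] q y(1) z(1) by algebra
    also have "A [^] N = a [^] (N ^ Suc t)"
      using assms by (simp add: A_def nat_pow_pow mult.commute)
    also have "q \<otimes> q = b [^] ((2::nat) ^ Suc t)"
      using assms by (simp add: q_def nat_pow_mult mult_2)
    finally show ?case using y(1) z(1) by blast
  qed
  obtain y where y: "y \<in> carrier R"
    "(a \<oplus> b) [^] (N ^ k) = a [^] (N ^ k) \<oplus> b [^] ((2::nat) ^ k) \<otimes> y"
    using step by blast
  \<comment> \<open>Since \<open>k < 2 ^ k\<close>, the factor \<open>b [^] k\<close> splits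
    off.\<close>
  have "b [^] ((2::nat) ^ k) = b [^] k \<otimes> b [^] (2 ^ k - k)"
    using nat_pow_mult[OF assms(2), of k "2 ^ k - k"] less_imp_le[OF less_exp[of k]]
    by (simp only: le_add_diff_inverse)
  then have "b [^] ((2::nat) ^ k) = \<zero>"
    using assms by simp
  then have "(a \<oplus> b) [^] (N ^ k) = a [^] (N ^ k)"
    using y assms by simp
  with N(1) show ?thesis by (metis zero_less_power)
qed

text \<open>Integer multiples are computed from zero and addition alone, which restricting the
  carrier leaves unchanged. Hence torsion statements pass between \<open>R\<close> and a
  subring.\<close>

lemma (in ring) add_pow_carrier_update:
  "add_pow (R\<lparr>carrier := S\<rparr>) (n::nat) x = [n] \<cdot> x"
  by (simp add: add_pow_def nat_pow_def)

lemma (in ring) torsion_if_strongly_semi_nil_clean_two: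
  assumes "strongly_semi_nil_clean_element R (\<one> \<oplus> \<one>)"
  shows "\<exists>N::nat. N > 0 \<and> [N] \<cdot> \<one> = \<zero>"
proof -
  \<comment> \<open>Periodicity is symmetric in its two exponents, so \<open>m < n\<close> may be
    assumed.\<close>
  obtain a b and m n k :: nat
    where ab: "a \<in> carrier R" "b \<in> carrier R" "\<one> \<oplus> \<one> = a \<oplus> b" "a \<otimes> b = b \<otimes> a"
      and mn: "m < n" "a [^] m = a [^] n" and k: "b [^] k = \<zero>"
    using assms
    unfolding strongly_semi_nil_clean_element_def periodic_element_def nilpotent_element_def
    by (metis linorder_neqE_nat)
  obtain S where S: "subcring S R" "a \<in> S" "b \<in> S"
    using commuting_pair_subcring[OF ab(1,2,4)] .
  interpret S: cring "R\<lparr>carrier := S\<rparr>"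
    using S(1) subcring_iff subcringE(1) by blast
  show ?thesis
    using S.torsion_of_two_eq_periodic_add_nilpotent[of a b m n k] ab mn k S(2,3)
    by (simp add: add_pow_carrier_update flip: nat_pow_consistent)
qed

lemma (in ring) periodic_element_if_strongly_semi_nil_clean_element:
  assumes "strongly_semi_nil_clean_element R x"
    and N: "(N::nat) > 0" "[N] \<cdot> \<one> = \<zero>"
  shows "periodic_element R x"
proof -
  obtain a b and m n k :: nat
    where ab: "a \<in> carrier R" "b \<in> carrier R" "x = a \<oplus> b" "a \<otimes> b = b \<otimes> a"
      and mn: "0 < m" "0 < n" "m \<noteq> n" "a [^] m = a [^] n" and k: "b [^] k = \<zero>"
    using assms(1)
    unfolding strongly_semi_nil_clean_element_def periodic_element_def nilpotent_element_def
    by blast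
  obtain S where S: "subcring S R" "a \<in> S" "b \<in> S"
    using commuting_pair_subcring[OF ab(1,2,4)] .
  interpret S: cring "R\<lparr>carrier := S\<rparr>"
    using S(1) subcring_iff subcringE(1) by blast
  obtain r :: nat where r: "r > 0" "x [^] r = a [^] r"
    using S.pow_add_nilpotent_eq_pow[of a b k N] ab(3) k S(2,3) N
    by (auto simp: add_pow_carrier_update simp flip: nat_pow_consistent)
  have x: "x \<in> carrier R" using ab by simp
  \<comment> \<open>Since \<open>x\<close> and \<open>a\<close> have the same \<open>r\<close>-th
    power, the relation between powers of \<open>a\<close> carries over to \<open>x\<close> with
    exponents multiplied by \<open>r\<close>. They remain positive and distinct because
    \<open>r > 0\<close>.\<close>
  have "x [^] (r * m) = (a [^] m) [^] r"
    using r(2) x ab(1) by (metis nat_pow_pow mult.commute)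
  also have "\<dots> = x [^] (r * n)"
    unfolding mn(4) using r(2) x ab(1) by (metis nat_pow_pow mult.commute)
  finally show ?thesis
    unfolding periodic_element_def using x r(1) mn(1-3)
    by (metis mult_cancel1 nat_0_less_mult_iff less_numeral_extra(3))
qed

theorem proposition2p3:
  fixes R :: "('a, 'b) ring_scheme" (structure)
  assumes "ring R"
  shows "strongly_semi_nil_clean_ring R \<longleftrightarrow> periodic_ring R"
proof
  interpret ring R by fact
  assume *: "strongly_semi_nil_clean_ring R"
  then obtain N :: nat where "N > 0" "[N] \<cdot> \<one> = \<zero>"
    using torsion_if_strongly_semi_nil_clean_two
    unfolding strongly_semi_nil_clean_ring_def by blast
  with * show "periodic_ring R"
    unfolding strongly_semi_nil_clean_ring_def periodic_ring_def
    using periodic_element_if_strongly_semi_nil_clean_element by blast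
next
  interpret ring R by fact
  assume *: "periodic_ring R"
  \<comment> \<open>For the converse, a periodic \<open>x\<close> decomposes as \<open>x\<close>
    plus the nilpotent element zero.\<close>
  have "nilpotent_element R \<zero>"
    unfolding nilpotent_element_def by (auto intro!: exI[of _ "1::nat"])
  moreover have "x = x \<oplus> \<zero>" "x \<otimes> \<zero> = \<zero> \<otimes> x" if "x \<in> carrier R" for x
    using that by auto
  ultimately show "strongly_semi_nil_clean_ring R"
    using * unfolding strongly_semi_nil_clean_ring_def strongly_semi_nil_clean_element_def
      periodic_ring_def by blast
qed

end
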